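(* Let $H\subset E$ and $(\nu_t)_{t>0}$, $(P_t)_{t\ge0}$ be as in the context, assume that (HS) and (H) hold, and let $x\in E\setminus H$ with $E_x$ the Borel linear subspace of $E$ defined in the context. Define $y\sim z$ on $E$ if and only if $y-z\in E_x$, and let $\tau\subset E$ contain exactly one representative of each equivalence class. Then $\tau$ is uncountable and $E=\bigcup_{z\in\tau}(E_x+z)$ is a disjoint union of Borel sets satisfying $P_t1_{E_x+z}=1_{E_x+z}$ for all $t>0$ and $z\in\tau$. Hence $E$ is an uncountable disjoint union of Borel sets which are invariant for the Lévy process on $E$.
   Context: $(H,\langle\cdot,\cdot\rangle)$ is a separable real Hilbert space with norm $|\cdot|$; $(E,\langle\cdot,\cdot\rangle_E)$ is a Hilbert space with norm $\|\cdot\|$ such that $H\subset E$ continuously and densely; identifying $H$ with $H'$, $E'\subset H\subset E$; ${}_{E'}\langle\xi,z\rangle_E=\xi(z)$. (HS): the embedding $H\subset E$ is Hilbert–Schmidt. $\psi:H\to\mathbb C$ is a continuous negative definite function (so that $e^{-t\psi}$ is positive definite for each $t>0$) with $\psi(0)=0$. For $t>0$, $\nu_t$ is the probability measure on $(E,\mathcal B(E))$ with $\int_E e^{i\,{}_{E'}\langle\xi,z\rangle_E}\nu_t(dz)=e^{-t\psi(\xi)}$, $\xi\in E'$. $P_tf(y)=\int_Ef(y+w)\nu_t(dw)$ is the transition semigroup of the associated Lévy process on $E$. (H): (i) there is $C>0$ such that $\int_E {}_{E'}\langle\xi,z\rangle_E^2\,\nu_t(dz)\le C(1+t^2)|\xi|^2$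 for all $\xi\in E'$, $t>0$; (ii) $\nu_t(H)=0$ for all $t>0$. Fix an orthonormal basis $\{e_n:n\ge1\}$ of $H$ contained in $E'$ and $\lambda_n\in(0,\infty)$ with $\sum_n\lambda_n<\infty$ such that $\overline e_n:=e_n/\sqrt{\lambda_n}$, $n\ge1$, form an orthonormal basis of $E$ and $\lambda_n\,{}_{E'}\langle e_n,z\rangle_E=\langle e_n,z\rangle_E$ for all $n$ and $z\in E$ (such a basis exists by (HS)). Let $\alpha_n\in(0,\infty)$, $\alpha_n\nearrow\infty$, with $\sum_n\alpha_n\lambda_n<\infty$. For $x\in E\setminus H$, fix an orthonormal basis $\{e_n^x:n\ge1\}$ of $H$ with $e_n^x\in E'$, separating the points of $E$, with ${}_{E'}\langle e_n^x,x\rangle_E\ge2^{n/2}$ for all $n$ (such a basis exists), and define $$q_x(z):=\Big[\sum_{n=1}^\infty\alpha_n\lambda_n\,{}_{E'}\langle e_n,z\rangle_E^2+\Big(\sum_{n=1}^\infty2^{-n/2}|{}_{E'}\langle e_n^x,z\rangle_E|\Big)^2\Big]^{1/2},\quad z\in E,$$ $E_x:=\{z\in E:q_x(z)<\infty\}$. *)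

theory Defs
  imports "HOL-Probability.Probability"
begin

text \<open>
  The inclusion of \<open>H\<close> into \<open>E\<close> is an explicit injective linear map \<open>j\<close>, so that the image of
  \<open>H\<close> in \<open>E\<close> is \<open>range j\<close>. All sequences are indexed by \<open>n \<ge> 1\<close>; values at \<open>0\<close> are irrelevant.
\<close>

definition dense_continuous_embedding ::
    "('h::real_normed_vector \<Rightarrow> 'e::real_normed_vector) \<Rightarrow> bool" where
  "dense_continuous_embedding j \<longleftrightarrow>
     bounded_linear j \<and> inj j \<and> closure (range j) = UNIV"

definition orthonormal_basis_on :: "'i set \<Rightarrow> ('i \<Rightarrow> 'a::real_inner) \<Rightarrow> bool" where
  "orthonormal_basis_on I e \<longleftrightarrow>
     (\<forall>m\<in>I. \<forall>n\<in>I. inner (e m) (e n) = (if m = n then 1 else 0)) \<and>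
     closure (span (e ` I)) = UNIV"

definition hilbert_schmidt :: "('h::real_inner \<Rightarrow> 'e::real_inner) \<Rightarrow> bool" where
  "hilbert_schmidt j \<longleftrightarrow>
     bounded_linear j \<and>
     (\<exists>B. orthonormal_basis_on B (\<lambda>b. b) \<and> (\<lambda>b. (norm (j b))\<^sup>2) summable_on B)"

text \<open>
  After identifying \<open>H\<close> with its dual, a continuous functional \<open>l\<close> on \<open>E\<close> is the vector of \<open>H\<close>
  representing its restriction \<open>l \<circ> j\<close> to \<open>H\<close>. By density of \<open>range j\<close> the functional is
  determined by this vector, so the description in \<open>dual_pairing\<close> is definite on \<open>dual_space j\<close>.
\<close>

definition dual_space :: "('h::real_inner \<Rightarrow> 'e::real_normed_vector) \<Rightarrow> 'h set" where
  "dual_space j = {\<xi>. \<exists>l::'e \<Rightarrow> real. bounded_linear l \<and> (\<forall>h. l (j h) = inner \<xi> h)}"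

definition dual_pairing ::
    "('h::real_inner \<Rightarrow> 'e::real_normed_vector) \<Rightarrow> 'h \<Rightarrow> 'e \<Rightarrow> real" where
  "dual_pairing j \<xi> = (THE l. bounded_linear l \<and> (\<forall>h. l (j h) = inner \<xi> h))"

text \<open>
  Negative definiteness in the sense of Schoenberg (as in Berg and Forst): the matrices with entries
  \<open>\<psi> (x\<^sub>k) + cnj (\<psi> (x\<^sub>m)) - \<psi> (x\<^sub>k - x\<^sub>m)\<close> are positive (semidefinite) Hermitian.
\<close>

definition negative_definite :: "('h::ab_group_add \<Rightarrow> complex) \<Rightarrow> bool" where
  "negative_definite \<psi> \<longleftrightarrow>
     (\<forall>(n::nat) (x::nat \<Rightarrow> 'h) (c::nat \<Rightarrow> complex).
        (\<Sum>k<n. \<Sum>m<n. (\<psi> (x k) + cnj (\<psi> (x m)) - \<psi> (x k - x m)) * c k * cnj (c m))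
          \<in> {w. Im w = 0 \<and> 0 \<le> Re w})"

definition transition_op ::
    "(real \<Rightarrow> 'e::real_normed_vector measure) \<Rightarrow> real \<Rightarrow> ('e \<Rightarrow> real) \<Rightarrow> 'e \<Rightarrow> real" where
  "transition_op \<nu> t f y = (\<integral>w. f (y + w) \<partial>\<nu> t)"

definition levy_invariant ::
    "(real \<Rightarrow> 'e::real_normed_vector measure) \<Rightarrow> 'e set \<Rightarrow> bool" where
  "levy_invariant \<nu> A \<longleftrightarrow> (\<forall>t>0. transition_op \<nu> t (indicator A) = indicator A)"

definition ennreal_sqrt :: "ennreal \<Rightarrow> ennreal" where
  "ennreal_sqrt a = (if a = \<infinity> then \<infinity> else ennreal (sqrt (enn2real a)))"

definition q_seminorm ::
    "('h::real_inner \<Rightarrow> 'e::real_normed_vector) \<Rightarrow> (nat \<Rightarrow> real) \<Rightarrow> (nat \<Rightarrow> real) \<Rightarrow>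
     (nat \<Rightarrow> 'h) \<Rightarrow> (nat \<Rightarrow> 'h) \<Rightarrow> 'e \<Rightarrow> ennreal" where
  "q_seminorm j \<alpha> lam e ex z = ennreal_sqrt
     ((\<Sum>\<^sub>\<infinity>n\<in>{1..}. ennreal (\<alpha> n * lam n * (dual_pairing j (e n) z)\<^sup>2)) +
      (\<Sum>\<^sub>\<infinity>n\<in>{1..}. ennreal (2 powr (- (real n / 2)) * \<bar>dual_pairing j (ex n) z\<bar>))\<^sup>2)"

definition finite_q_space ::
    "('h::real_inner \<Rightarrow> 'e::real_normed_vector) \<Rightarrow> (nat \<Rightarrow> real) \<Rightarrow> (nat \<Rightarrow> real) \<Rightarrow>
     (nat \<Rightarrow> 'h) \<Rightarrow> (nat \<Rightarrow> 'h) \<Rightarrow> 'e set" where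
  "finite_q_space j \<alpha> lam e ex = {z. q_seminorm j \<alpha> lam e ex z < \<infinity>}"

definition translate :: "'e::ab_group_add set \<Rightarrow> 'e \<Rightarrow> 'e set" where
  "translate V z = (\<lambda>v. v + z) ` V"

definition diff_rel :: "'e::ab_group_add set \<Rightarrow> ('e \<times> 'e) set" where
  "diff_rel V = {(y, z). y - z \<in> V}"

end

theory Submission
  imports Defs
begin

text \<open>
  The space \<open>finite_q_space\<close> is a Borel linear subspace cut out by the finiteness of two weighted
  series of continuous functionals. By (H)(i) both series have finite \<open>\<nu> t\<close>-expectation, so
  \<open>\<nu> t\<close> is carried by the subspace, and a process with increments in a subspace never leaves a
  coset. The second series diverges at \<open>x\<close>, hence the line \<open>\<real> x\<close> meets each coset at most
  once and there are uncountably many cosets.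
\<close>

section \<open>Dual pairing\<close>

text \<open>Two continuous functionals that agree on \<open>range j\<close> agree on its closure,
  which is the whole space. So the definite description in \<open>dual_pairing\<close> has a unique
  witness, and linearity and Borel measurability of the pairing follow from this lemma.\<close>

lemma dual_pairing_bounded_linear:
  assumes "dense_continuous_embedding j" "\<xi> \<in> dual_space j"
  shows "bounded_linear (dual_pairing j \<xi>)"
proof -
  obtain l where l: "bounded_linear l" "\<And>h. l (j h) = inner \<xi> h"
    using assms(2) unfolding dual_space_def by auto
  have uniq: "l' = l" if l': "bounded_linear l'" "\<forall>h. l' (j h) = inner \<xi> h" for l'
  proof
    fix z
    have "closed {z. l' z = l z}"
      by (intro closed_Collect_eq linear_continuous_on l' l)
    moreover have "range j \<subseteq> {z. l' z = l z}"
      using l l' by auto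
    ultimately have "closure (range j) \<subseteq> {z. l' z = l z}"
      by (rule closure_minimal[rotated])
    then show "l' z = l z"
      using assms(1) unfolding dense_continuous_embedding_def by auto
  qed
  have "dual_pairing j \<xi> = l"
    unfolding dual_pairing_def using l uniq by (intro the_equality) blast+
  then show ?thesis using l by simp
qed

section \<open>Series of extended nonnegative reals\<close>

lemma range_Suc: "range Suc = {1..}"
  by (auto simp: image_iff Suc_le_eq gr0_conv_Suc)

text \<open>Every family in \<open>ennreal\<close> is summable, so the unordered sum can be
  reindexed along \<open>Suc\<close> and read as an ordinary series. The form with
  \<open>suminf\<close> is the one to which Tonelli and the measurability rules apply.\<close>

lemma infsum_atLeast_1_eq_suminf:
  fixes f :: "nat \<Rightarrow> ennreal"
  shows "(\<Sum>\<^sub>\<infinity>n\<in>{1..}. f n) = (\<Sum>n. f (Suc n))"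
proof -
  have "(\<Sum>\<^sub>\<infinity>n\<in>{1..}. f n) = (\<Sum>\<^sub>\<infinity>n. f (Suc n))"
    using infsum_reindex[of Suc UNIV f] by (simp add: o_def range_Suc)
  also have "\<dots> = (\<Sum>n. f (Suc n))"
    by (intro sums_unique has_sum_imp_sums has_sum_infsum nonneg_summable_on_complete) simp
  finally show ?thesis .
qed

lemma suminf_ennreal_finite_iff:
  assumes "\<And>n. 0 \<le> f n"
  shows "(\<Sum>n. ennreal (f n)) < \<infinity> \<longleftrightarrow> summable f"
proof
  show "summable f" if "(\<Sum>n. ennreal (f n)) < \<infinity>"
    using assms that by (intro summable_suminf_not_top) auto
  show "(\<Sum>n. ennreal (f n)) < \<infinity>" if "summable f"
    using suminf_ennreal2[OF assms that] by simp
qed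

lemma ennreal_sqrt_finite_iff: "ennreal_sqrt a < \<infinity> \<longleftrightarrow> a < \<infinity>"
  unfolding ennreal_sqrt_def by (simp add: less_top[symmetric])

text \<open>By Tonelli the expectation of the series is at most K times the sum of the weights. A
  nonnegative function with finite integral is finite almost everywhere.\<close>

lemma (in prob_space) AE_weighted_suminf_finite:
  assumes "\<And>n. f n \<in> borel_measurable M"
    and "\<And>n. 0 \<le> w n" "\<And>n x. 0 \<le> f n x" "summable w"
    and "0 \<le> K" "\<And>n. (\<integral>\<^sup>+x. ennreal (f n x) \<partial>M) \<le> ennreal K"
  shows "AE x in M. (\<Sum>n. ennreal (w n * f n x)) < \<infinity>"
proof -
  note [measurable] = assms(1)
  have "(\<integral>\<^sup>+x. (\<Sum>n. ennreal (w n * f n x)) \<partial>M) = (\<Sum>n. \<integral>\<^sup>+x. ennreal (w n * f n x) \<partial>M)"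
    by (intro nn_integral_suminf) measurable
  also have "\<dots> = (\<Sum>n. ennreal (w n) * (\<integral>\<^sup>+x. ennreal (f n x) \<partial>M))"
    using assms(2,3) by (simp add: ennreal_mult nn_integral_cmult)
  also have "\<dots> \<le> (\<Sum>n. ennreal (w n * K))"
    using assms(2,5,6) by (intro suminf_le) (auto simp: ennreal_mult intro: mult_left_mono)
  also have "\<dots> < \<infinity>"
    using assms(2,4,5) by (subst suminf_ennreal_finite_iff) (auto intro: summable_mult2)
  finally have "AE x in M. (\<Sum>n. ennreal (w n * f n x)) \<noteq> \<infinity>"
    by (intro nn_integral_noteq_infinite) auto
  then show ?thesis by (simp add: less_top[symmetric])
qed

section \<open>Cosets of a subspace\<close>

lemma mem_translate_iff: "y \<in> translate V z \<longleftrightarrow> y - z \<in> V"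
  unfolding translate_def by (auto intro: image_eqI[of _ _ "y - z"])

text \<open>The image of z consists of the y with z - y in V, whereas the translate asks for y - z
  in V. Closure of V under negation reconciles the two orientations.\<close>

lemma diff_rel_Image:
  assumes "subspace V"
  shows "diff_rel V `` {z} = translate V z"
proof -
  have "z - y \<in> V \<longleftrightarrow> y - z \<in> V" for y
    using subspace_neg[OF assms, of "y - z"] subspace_neg[OF assms, of "z - y"] by auto
  then show ?thesis
    unfolding diff_rel_def set_eq_iff mem_translate_iff by simp
qed

lemma translate_borel:
  assumes "V \<in> sets borel"
  shows "translate V (z :: 'a::real_normed_vector) \<in> sets borel"
proof -
  have "(\<lambda>y. y - z) \<in> borel_measurable borel"
    by (intro borel_measurable_continuous_onI continuous_intros)
  from measurable_sets[OF this assms] show ?thesis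
    by (simp add: vimage_def mem_translate_iff[symmetric])
qed

text \<open>Almost every increment w lies in V, so y + w and y belong to the same coset. The
  integrand is therefore almost everywhere the constant \<open>indicator (translate V z) y\<close>,
  and \<open>\<nu> t\<close> has mass one.\<close>

lemma levy_invariant_translate:
  fixes V :: "'a::real_normed_vector set"
  assumes V: "subspace V" and borel: "V \<in> sets borel"
    and prob: "\<And>t. t > 0 \<Longrightarrow> prob_space (\<nu> t)"
    and sets: "\<And>t. t > 0 \<Longrightarrow> sets (\<nu> t) = sets borel"
    and carried: "\<And>t. t > 0 \<Longrightarrow> AE w in \<nu> t. w \<in> V"
  shows "levy_invariant \<nu> (translate V z)"
  unfolding levy_invariant_def
proof (intro allI impI ext)
  fix t :: real and y
  assume "t > 0"
  then interpret prob_space "\<nu> t" by (rule prob)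
  have "AE w in \<nu> t. indicator (translate V z) (y + w) = (indicator (translate V z) y :: real)"
    using carried[OF \<open>t > 0\<close>]
  proof eventually_elim
    case (elim w)
    \<comment> \<open>The two rearrangements serve the two directions of the equivalence: one adds w
      within V, the other subtracts it.\<close>
    have "y + w - z = (y - z) + w" "y - z = (y + w - z) - w"
      by simp_all
    then have "y + w - z \<in> V \<longleftrightarrow> y - z \<in> V"
      using subspace_add[OF V _ elim] subspace_diff[OF V _ elim] by metis
    then show ?case by (simp add: indicator_def mem_translate_iff)
  qed
  moreover have "(\<lambda>w. indicator (translate V z) (y + w)) \<in> borel_measurable (\<nu> t)"
    using translate_borel[OF borel, of z]
    unfolding measurable_cong_sets[OF sets[OF \<open>t > 0\<close>] refl] by measurable
  ultimately have "transition_op \<nu> t (indicator (translate V z)) y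
      = (\<integral>w. indicator (translate V z) y \<partial>\<nu> t)"
    unfolding transition_op_def by (intro integral_cong_AE) simp_all
  then show "transition_op \<nu> t (indicator (translate V z)) y = indicator (translate V z) y"
    by (simp add: prob_space)
qed

text \<open>Sending a real r to a representative of the coset of r x is injective: if r x and s x
  shared a coset with r \<noteq> s, then (r - s) x, and hence x, would lie in V. So the
  representatives are at least as many as the reals.\<close>

lemma uncountable_transversal:
  fixes V :: "'a::real_vector set"
  assumes V: "subspace V" and "x \<notin> V"
    and cover: "\<And>y. \<exists>z\<in>\<tau>. y \<in> translate V z"
  shows "uncountable \<tau>"
proof
  assume "countable \<tau>"
  obtain g where g: "\<And>y. g y \<in> \<tau>" "\<And>y. y \<in> translate V (g y)"
    using cover by metis
  have "inj (\<lambda>r::real. g (r *\<^sub>R x))"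
  proof (rule injI, rule ccontr)
    fix r s :: real
    assume eq: "g (r *\<^sub>R x) = g (s *\<^sub>R x)" and "r \<noteq> s"
    have "r *\<^sub>R x - g (r *\<^sub>R x) \<in> V" "s *\<^sub>R x - g (r *\<^sub>R x) \<in> V"
      using g(2)[of "r *\<^sub>R x"] g(2)[of "s *\<^sub>R x"] unfolding eq mem_translate_iff .
    from subspace_diff[OF V this] have "(r - s) *\<^sub>R x \<in> V"
      by (simp add: scaleR_left_diff_distrib)
    from subspace_scale[OF V this, of "1 / (r - s)"] show False
      using \<open>r \<noteq> s\<close> \<open>x \<notin> V\<close> by simp
  qed
  moreover have "countable (range (\<lambda>r::real. g (r *\<^sub>R x)))"
    using \<open>countable \<tau>\<close> by (rule countable_subset[rotated]) (use g in auto)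
  ultimately show False
    using countable_image_inj_on uncountable_UNIV_real by blast
qed

section \<open>The subspace of finite \<open>q_seminorm\<close>\<close>

lemma summable_two_powr_neg_half: "summable (\<lambda>n. 2 powr - (real n / 2))"
proof -
  \<comment> \<open>The weights form a geometric sequence with ratio
    \<open>2 powr - (1 / 2)\<close>, which is below one.\<close>
  have "2 powr - (real n / 2) = (2 powr - (1 / 2)) ^ n" for n
    by (simp add: powr_realpow[symmetric] powr_powr)
  then show ?thesis
    by (simp add: summable_geometric powr_less_one)
qed

text \<open>Neither the outer square root nor the square of the second series affects finiteness, so
  membership splits into two separate conditions. This extended form serves measurability and the
  almost sure statement.\<close>

lemma finite_q_space_eq_suminf:
  "finite_q_space j \<alpha> lam e ex =
    {z. (\<Sum>n. ennreal (\<alpha> (Suc n) * lam (Suc n) * (dual_pairing j (e (Suc n)) z)\<^sup>2)) < \<infinity> \<and>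
        (\<Sum>n. ennreal (2 powr - (real (Suc n) / 2) * \<bar>dual_pairing j (ex (Suc n)) z\<bar>)) < \<infinity>}"
  unfolding finite_q_space_def q_seminorm_def ennreal_sqrt_finite_iff infsum_atLeast_1_eq_suminf
  by (simp add: power_less_top_ennreal)

text \<open>The form with real summability serves the algebraic closure properties. Since
  \<open>ennreal\<close> truncates negative reals to zero, the translation asks for nonnegative
  weights.\<close>

lemma finite_q_space_eq_summable:
  assumes "\<And>n. n \<ge> 1 \<Longrightarrow> 0 \<le> \<alpha> n * lam n"
  shows "finite_q_space j \<alpha> lam e ex =
    {z. summable (\<lambda>n. \<alpha> (Suc n) * lam (Suc n) * (dual_pairing j (e (Suc n)) z)\<^sup>2) \<and>
        summable (\<lambda>n. 2 powr - (real (Suc n) / 2) * \<bar>dual_pairing j (ex (Suc n)) z\<bar>)}"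
  using assms unfolding finite_q_space_eq_suminf
  by (subst (1 2) suminf_ennreal_finite_iff) auto

text \<open>Sums are handled by comparison through the triangle inequality, scalar multiples by
  homogeneity.\<close>

lemma subspace_summable_weighted_abs:
  assumes "\<And>n. linear (l n)" and w: "\<And>n. 0 \<le> w n"
  shows "subspace {z. summable (\<lambda>n. w n * \<bar>l n z :: real\<bar>)}"
proof (rule subspaceI; safe?)
  interpret linear "l n" for n by fact
  show "summable (\<lambda>n. w n * \<bar>l n 0\<bar>)" by (simp add: zero)
  fix y z
  assume "summable (\<lambda>n. w n * \<bar>l n y\<bar>)" and "summable (\<lambda>n. w n * \<bar>l n z\<bar>)"
  then have "summable (\<lambda>n. w n * \<bar>l n y\<bar> + w n * \<bar>l n z\<bar>)" by (rule summable_add)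
  then show "summable (\<lambda>n. w n * \<bar>l n (y + z)\<bar>)"
  proof (rule summable_comparison_test'[where N = 0])
    show "norm (w n * \<bar>l n (y + z)\<bar>) \<le> w n * \<bar>l n y\<bar> + w n * \<bar>l n z\<bar>" for n
      using w[of n] mult_left_mono[OF abs_triangle_ineq[of "l n y" "l n z"] w[of n]]
      by (simp add: add abs_mult distrib_left)
  qed
next
  interpret linear "l n" for n by fact
  fix c z
  assume "summable (\<lambda>n. w n * \<bar>l n z\<bar>)"
  then have "summable (\<lambda>n. \<bar>c\<bar> * (w n * \<bar>l n z\<bar>))" by (rule summable_mult)
  then show "summable (\<lambda>n. w n * \<bar>l n (c *\<^sub>R z)\<bar>)"
    by (simp add: scale abs_mult mult_ac)
qed

lemma subspace_summable_weighted_square: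
  assumes "\<And>n. linear (l n)" and w: "\<And>n. 0 \<le> w n"
  shows "subspace {z. summable (\<lambda>n. w n * (l n z :: real)\<^sup>2)}"
proof (rule subspaceI; safe?)
  interpret linear "l n" for n by fact
  show "summable (\<lambda>n. w n * (l n 0)\<^sup>2)" by (simp add: zero)
  fix y z
  assume "summable (\<lambda>n. w n * (l n y)\<^sup>2)" and "summable (\<lambda>n. w n * (l n z)\<^sup>2)"
  then have "summable (\<lambda>n. 2 * (w n * (l n y)\<^sup>2 + w n * (l n z)\<^sup>2))"
    by (intro summable_mult summable_add)
  then show "summable (\<lambda>n. w n * (l n (y + z))\<^sup>2)"
  proof (rule summable_comparison_test'[where N = 0])
    fix n
    \<comment> \<open>The right side exceeds the left by exactly the square of
      \<open>l n y - l n z\<close>; this inequality plays the part of the triangle inequality for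
      squares.\<close>
    have "(l n y + l n z)\<^sup>2 \<le> 2 * ((l n y)\<^sup>2 + (l n z)\<^sup>2)"
      using zero_le_power2[of "l n y - l n z"] by (simp add: power2_eq_square algebra_simps)
    from mult_left_mono[OF this w[of n]]
    show "norm (w n * (l n (y + z))\<^sup>2) \<le> 2 * (w n * (l n y)\<^sup>2 + w n * (l n z)\<^sup>2)"
      using w[of n] by (simp add: add algebra_simps)
  qed
next
  interpret linear "l n" for n by fact
  fix c z
  assume "summable (\<lambda>n. w n * (l n z)\<^sup>2)"
  then have "summable (\<lambda>n. c\<^sup>2 * (w n * (l n z)\<^sup>2))" by (rule summable_mult)
  then show "summable (\<lambda>n. w n * (l n (c *\<^sub>R z))\<^sup>2)"
    by (simp add: scale power_mult_distrib mult_ac)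
qed

lemma subspace_finite_q_space:
  assumes "dense_continuous_embedding j"
    and "\<And>n. n \<ge> 1 \<Longrightarrow> e n \<in> dual_space j" "\<And>n. n \<ge> 1 \<Longrightarrow> ex n \<in> dual_space j"
    and "\<And>n. n \<ge> 1 \<Longrightarrow> 0 \<le> \<alpha> n * lam n"
  shows "subspace (finite_q_space j \<alpha> lam e ex)"
proof -
  have lin: "linear (dual_pairing j (e (Suc n)))" "linear (dual_pairing j (ex (Suc n)))" for n
    using assms by (auto intro!: bounded_linear.linear dual_pairing_bounded_linear)
  show ?thesis
    by (subst finite_q_space_eq_summable[OF assms(4)], simp, subst Collect_conj_eq)
      (intro subspace_inter subspace_summable_weighted_square subspace_summable_weighted_abs lin,
        auto intro: assms(4))
qed

text \<open>Both series are countable sums of Borel functions with values in \<open>ennreal\<close>,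
  and the space is where both are finite.\<close>

lemma borel_finite_q_space:
  assumes "dense_continuous_embedding j"
    and "\<And>n. n \<ge> 1 \<Longrightarrow> e n \<in> dual_space j" "\<And>n. n \<ge> 1 \<Longrightarrow> ex n \<in> dual_space j"
  shows "finite_q_space j \<alpha> lam e ex \<in> sets borel"
proof -
  have [measurable]: "dual_pairing j (e (Suc n)) \<in> borel_measurable borel"
    "dual_pairing j (ex (Suc n)) \<in> borel_measurable borel" for n
    using assms by (auto intro!: borel_measurable_continuous_onI linear_continuous_on
      dual_pairing_bounded_linear)
  show ?thesis
    unfolding finite_q_space_eq_suminf by measurable
qed

text \<open>The weight of index n is the reciprocal of the lower bound for the pairing with x, so
  every term of the second series is at least 1 and the series diverges.\<close>

lemma not_mem_finite_q_space:
  assumes "\<And>n. n \<ge> 1 \<Longrightarrow> dual_pairing j (ex n) x \<ge> 2 powr (real n / 2)"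
  shows "x \<notin> finite_q_space j \<alpha> lam e ex"
proof
  assume "x \<in> finite_q_space j \<alpha> lam e ex"
  then have "summable (\<lambda>n. 2 powr - (real (Suc n) / 2) * \<bar>dual_pairing j (ex (Suc n)) x\<bar>)"
    unfolding finite_q_space_eq_suminf by (subst suminf_ennreal_finite_iff[symmetric]) auto
  then have "summable (\<lambda>n. 1 :: real)"
  proof (rule summable_comparison_test'[where N = 0])
    fix n
    have "2 powr - (real (Suc n) / 2) * 2 powr (real (Suc n) / 2) = (1 :: real)"
      by (simp add: powr_add[symmetric])
    then show "norm (1 :: real) \<le> 2 powr - (real (Suc n) / 2) * \<bar>dual_pairing j (ex (Suc n)) x\<bar>"
      using mult_left_mono[OF order_trans[OF assms[of "Suc n"] abs_ge_self],
        of "2 powr - (real (Suc n) / 2)"] by simp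
  qed
  then show False by (simp add: summable_const_iff)
qed

text \<open>A second moment bound K uniform in n controls both series: directly for the squares,
  with weights \<open>\<alpha> n * lam n\<close>, and through first moments for the absolute values,
  with geometric weights.\<close>

lemma AE_finite_q_space:
  assumes "dense_continuous_embedding j" "prob_space M" "sets M = sets borel"
    and dual: "\<And>n. n \<ge> 1 \<Longrightarrow> e n \<in> dual_space j" "\<And>n. n \<ge> 1 \<Longrightarrow> ex n \<in> dual_space j"
    and "\<And>n. n \<ge> 1 \<Longrightarrow> 0 \<le> \<alpha> n * lam n" "(\<lambda>n. \<alpha> n * lam n) summable_on {1..}"
    and "0 \<le> K"
    and moment: "\<And>n. n \<ge> 1 \<Longrightarrow> (\<integral>\<^sup>+z. ennreal ((dual_pairing j (e n) z)\<^sup>2) \<partial>M) \<le> ennreal K"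
      "\<And>n. n \<ge> 1 \<Longrightarrow> (\<integral>\<^sup>+z. ennreal ((dual_pairing j (ex n) z)\<^sup>2) \<partial>M) \<le> ennreal K"
  shows "AE z in M. z \<in> finite_q_space j \<alpha> lam e ex"
proof -
  interpret prob_space M by fact
  have [measurable]: "dual_pairing j (e (Suc n)) \<in> borel_measurable M"
    "dual_pairing j (ex (Suc n)) \<in> borel_measurable M" for n
    unfolding measurable_cong_sets[OF assms(3) refl] using assms(1) dual
    by (auto intro!: borel_measurable_continuous_onI linear_continuous_on dual_pairing_bounded_linear)
  have "(\<lambda>n. \<alpha> (Suc n) * lam (Suc n)) summable_on UNIV"
    using assms(7) summable_on_reindex[of Suc UNIV "\<lambda>n. \<alpha> n * lam n"]
    by (simp add: o_def range_Suc)
  then have "summable (\<lambda>n. \<alpha> (Suc n) * lam (Suc n))"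
    by (rule summable_on_imp_summable)
  then have squares: "AE z in M.
      (\<Sum>n. ennreal (\<alpha> (Suc n) * lam (Suc n) * (dual_pairing j (e (Suc n)) z)\<^sup>2)) < \<infinity>"
    using assms(6,8) moment(1) by (intro AE_weighted_suminf_finite[where K = K]) auto
  have abs_moment: "(\<integral>\<^sup>+z. ennreal \<bar>dual_pairing j (ex (Suc n)) z\<bar> \<partial>M) \<le> ennreal (1 + K)" for n
  proof -
    have "(\<integral>\<^sup>+z. ennreal \<bar>dual_pairing j (ex (Suc n)) z\<bar> \<partial>M)
        \<le> (\<integral>\<^sup>+z. 1 + ennreal ((dual_pairing j (ex (Suc n)) z)\<^sup>2) \<partial>M)"
    proof (rule nn_integral_mono)
      fix z
      \<comment> \<open>Expanding the square of \<open>\<bar>a\<bar> - 1\<close> gives twice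
        \<open>\<bar>a\<bar>\<close> on the left, more than enough. Integrated against a probability
        measure, the bound turns K into 1 + K.\<close>
      have "\<bar>a\<bar> \<le> 1 + a\<^sup>2" for a :: real
        using zero_le_power2[of "\<bar>a\<bar> - 1"] abs_ge_zero[of a]
        unfolding power2_diff power2_abs one_power2 mult_1_right by linarith
      from ennreal_leI[OF this] show "ennreal \<bar>dual_pairing j (ex (Suc n)) z\<bar>
          \<le> 1 + ennreal ((dual_pairing j (ex (Suc n)) z)\<^sup>2)"
        by simp
    qed
    also have "\<dots> = 1 + (\<integral>\<^sup>+z. ennreal ((dual_pairing j (ex (Suc n)) z)\<^sup>2) \<partial>M)"
      by (subst nn_integral_add) (auto simp: emeasure_space_1)
    also have "\<dots> \<le> 1 + ennreal K"
      using moment(2) by (intro add_left_mono) simp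
    finally show ?thesis using \<open>0 \<le> K\<close> by simp
  qed
  have "summable (\<lambda>n. 2 powr - (real (Suc n) / 2))"
    using summable_two_powr_neg_half by (subst summable_Suc_iff)
  then have "AE z in M.
      (\<Sum>n. ennreal (2 powr - (real (Suc n) / 2) * \<bar>dual_pairing j (ex (Suc n)) z\<bar>)) < \<infinity>"
    using \<open>0 \<le> K\<close> abs_moment by (intro AE_weighted_suminf_finite[where K = "1 + K"]) auto
  with squares show ?thesis
    unfolding finite_q_space_eq_suminf by auto
qed

theorem mainTheorem7:
  fixes j :: "'h::{real_inner, polish_space} \<Rightarrow> 'e::{real_inner, complete_space}"
    and \<psi> :: "'h \<Rightarrow> complex"
    and \<nu> :: "real \<Rightarrow> 'e measure"
    and e ex :: "nat \<Rightarrow> 'h"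
    and lam \<alpha> :: "nat \<Rightarrow> real"
    and x :: 'e
    and \<tau> :: "'e set"
  assumes embedding: "dense_continuous_embedding j"
    and HS: "hilbert_schmidt j"
    and psi_cont: "continuous_on UNIV \<psi>"
    and psi_neg_def: "negative_definite \<psi>"
    and psi_0: "\<psi> 0 = 0"
    and nu_prob: "\<And>t. t > 0 \<Longrightarrow> prob_space (\<nu> t)"
    and nu_sets: "\<And>t. t > 0 \<Longrightarrow> sets (\<nu> t) = sets borel"
    and nu_char: "\<And>t \<xi>. t > 0 \<Longrightarrow> \<xi> \<in> dual_space j \<Longrightarrow>
          (\<integral>z. exp (\<i> * complex_of_real (dual_pairing j \<xi> z)) \<partial>\<nu> t)
            = exp (- (complex_of_real t * \<psi> \<xi>))"
    and H_i: "\<exists>C>0. \<forall>\<xi>\<in>dual_space j. \<forall>t>0.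
          (\<integral>\<^sup>+z. ennreal ((dual_pairing j \<xi> z)\<^sup>2) \<partial>\<nu> t)
            \<le> ennreal (C * (1 + t\<^sup>2) * (norm \<xi>)\<^sup>2)"
    and H_ii: "\<And>t. t > 0 \<Longrightarrow> range j \<in> null_sets (\<nu> t)"
    and e_basis: "orthonormal_basis_on {1..} e"
    and e_dual: "\<And>n. n \<ge> 1 \<Longrightarrow> e n \<in> dual_space j"
    and lam_pos: "\<And>n. n \<ge> 1 \<Longrightarrow> lam n > 0"
    and lam_summable: "lam summable_on {1..}"
    and e_bar_basis: "orthonormal_basis_on {1..} (\<lambda>n. j (e n) /\<^sub>R sqrt (lam n))"
    and e_inner: "\<And>n z. n \<ge> 1 \<Longrightarrow> lam n * dual_pairing j (e n) z = inner (j (e n)) z"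
    and alpha_pos: "\<And>n. n \<ge> 1 \<Longrightarrow> \<alpha> n > 0"
    and alpha_mono: "mono_on {1..} \<alpha>"
    and alpha_top: "filterlim \<alpha> at_top sequentially"
    and alpha_summable: "(\<lambda>n. \<alpha> n * lam n) summable_on {1..}"
    and x_notin: "x \<notin> range j"
    and ex_basis: "orthonormal_basis_on {1..} ex"
    and ex_dual: "\<And>n. n \<ge> 1 \<Longrightarrow> ex n \<in> dual_space j"
    and ex_separates: "\<And>y z. y \<noteq> z \<Longrightarrow> \<exists>n\<ge>1. dual_pairing j (ex n) y \<noteq> dual_pairing j (ex n) z"
    and ex_x: "\<And>n. n \<ge> 1 \<Longrightarrow> dual_pairing j (ex n) x \<ge> 2 powr (real n / 2)"
    and tau: "\<And>K. K \<in> UNIV // diff_rel (finite_q_space j \<alpha> lam e ex) \<Longrightarrow> \<exists>!z. z \<in> K \<inter> \<tau>"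
  shows "subspace (finite_q_space j \<alpha> lam e ex)
    \<and> finite_q_space j \<alpha> lam e ex \<in> sets borel
    \<and> uncountable \<tau>
    \<and> (\<Union>z\<in>\<tau>. translate (finite_q_space j \<alpha> lam e ex) z) = UNIV
    \<and> disjoint_family_on (translate (finite_q_space j \<alpha> lam e ex)) \<tau>
    \<and> (\<forall>z\<in>\<tau>. translate (finite_q_space j \<alpha> lam e ex) z \<in> sets borel)
    \<and> (\<forall>t>0. \<forall>z\<in>\<tau>. transition_op \<nu> t (indicator (translate (finite_q_space j \<alpha> lam e ex) z))
          = indicator (translate (finite_q_space j \<alpha> lam e ex) z))
    \<and> (\<exists>\<A>. uncountable \<A> \<and> disjoint \<A> \<and> \<Union>\<A> = (UNIV :: 'e set)
          \<and> (\<forall>A\<in>\<A>. A \<in> sets borel \<and> levy_invariant \<nu> A))"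
proof -
  let ?V = "finite_q_space j \<alpha> lam e ex"
  have nonneg: "0 \<le> \<alpha> n * lam n" if "n \<ge> 1" for n
    using alpha_pos[OF that] lam_pos[OF that] by simp
  have V: "subspace ?V"
    using embedding e_dual ex_dual nonneg by (rule subspace_finite_q_space)
  have borel: "?V \<in> sets borel"
    using embedding e_dual ex_dual by (rule borel_finite_q_space)
  have carried: "AE z in \<nu> t. z \<in> ?V" if "t > 0" for t
  proof -
    obtain C where "C > 0" and C: "\<And>\<xi>. \<xi> \<in> dual_space j \<Longrightarrow>
        (\<integral>\<^sup>+z. ennreal ((dual_pairing j \<xi> z)\<^sup>2) \<partial>\<nu> t) \<le> ennreal (C * (1 + t\<^sup>2) * (norm \<xi>)\<^sup>2)"
      using H_i \<open>t > 0\<close> by blast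
    \<comment> \<open>Unit norms make the bound in (H)(i) independent of n; for fixed t it is the
      constant \<open>C * (1 + t\<^sup>2)\<close>, used as K for both bases.\<close>
    have "norm (e n) = 1" "norm (ex n) = 1" if "n \<ge> 1" for n
      using e_basis ex_basis that by (auto simp: orthonormal_basis_on_def norm_eq_1)
    then show ?thesis
      using C[OF e_dual] C[OF ex_dual] \<open>C > 0\<close>
      by (intro AE_finite_q_space[OF embedding nu_prob[OF that] nu_sets[OF that] e_dual ex_dual
        nonneg alpha_summable, where K = "C * (1 + t\<^sup>2)"]) simp_all
  qed
  \<comment> \<open>The equivalence classes in \<open>tau\<close> are exactly the translates of the
    subspace.\<close>
  have rep: "\<exists>!z. z \<in> translate ?V y \<inter> \<tau>" for y
    using tau quotientI[of y UNIV "diff_rel ?V"] unfolding diff_rel_Image[OF V] by simp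
  have sym: "y \<in> translate ?V z \<longleftrightarrow> z \<in> translate ?V y" for y z
    using subspace_neg[OF V, of "y - z"] subspace_neg[OF V, of "z - y"]
    unfolding mem_translate_iff minus_diff_eq by blast
  \<comment> \<open>The representative z chosen in the coset of y lies in y + V; symmetry puts y in
    z + V.\<close>
  have cover: "\<exists>z\<in>\<tau>. y \<in> translate ?V z" for y
    using rep[of y] sym by blast
  have unc: "uncountable \<tau>"
    using V not_mem_finite_q_space[OF ex_x] cover by (rule uncountable_transversal)
  have union: "(\<Union>z\<in>\<tau>. translate ?V z) = UNIV"
    using cover by auto
  have disj: "disjoint_family_on (translate ?V) \<tau>"
  proof -
    \<comment> \<open>By symmetry y and z are both representatives in the coset of w, so uniqueness
      identifies them.\<close>
    have "y = z" if "y \<in> \<tau>" "z \<in> \<tau>" "w \<in> translate ?V y" "w \<in> translate ?V z" for w y z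
      using rep[of w] that sym[of w] by blast
    then show ?thesis unfolding disjoint_family_on_def by blast
  qed
  have inv: "levy_invariant \<nu> (translate ?V z)" for z
    using V borel nu_prob nu_sets carried by (rule levy_invariant_translate)
  \<comment> \<open>Translates of distinct representatives are disjoint and nonempty, hence distinct
    sets. This carries uncountability from \<open>\<tau>\<close> to the family of cosets.\<close>
  have "z \<in> translate ?V z" for z
    using subspace_0[OF V] by (simp add: mem_translate_iff)
  then have "inj_on (translate ?V) \<tau>"
    using disj unfolding inj_on_def disjoint_family_on_def by blast
  then have "uncountable (translate ?V ` \<tau>)"
    using unc countable_image_inj_on by blast
  moreover have "disjoint (translate ?V ` \<tau>)"
    using disj by (rule disjoint_family_on_disjoint_image)
  moreover have "\<forall>A\<in>translate ?V ` \<tau>. A \<in> sets borel \<and> levy_invariant \<nu> A"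
    using inv translate_borel[OF borel] by blast
  ultimately have "\<exists>\<A>. uncountable \<A> \<and> disjoint \<A> \<and> \<Union>\<A> = (UNIV :: 'e set)
      \<and> (\<forall>A\<in>\<A>. A \<in> sets borel \<and> levy_invariant \<nu> A)"
    using union by (intro exI[of _ "translate ?V ` \<tau>"] conjI)
  moreover have "\<forall>t>0. \<forall>z\<in>\<tau>. transition_op \<nu> t (indicator (translate ?V z)) = indicator (translate ?V z)"
    using inv unfolding levy_invariant_def by simp
  moreover have "\<forall>z\<in>\<tau>. translate ?V z \<in> sets borel"
    using translate_borel[OF borel] by simp
  ultimately show ?thesis
    using V borel unc union disj by (intro conjI)
qed

end
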